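(* Let $\Sigma: x^+=f(x,u)$ be a discrete-time system with $f:\mathcal{X}\times\mathcal{U}\to\mathcal{X}$, $\mathcal{X}\subseteq\mathbb{R}^n$, $\mathcal{U}\subseteq\mathbb{R}^m$. Let $X\subseteq\mathcal{X}$ be a target set and let $S_{xu}=S_x\times S_u\subseteq\mathcal{X}\times\mathcal{U}$ be a constraint set. Let $\psi:\mathcal{X}\to\mathbb{R}^p$ be a lifting function and let $\Sigma_{lin}: z^+=Az+Bu+w$, $w\in W\subseteq\mathbb{R}^p$, be an uncertain linear system such that $(\psi,\Sigma_{lin})$ is a Koopman over-approximation of $\Sigma$ over $S_{xu}=S_x\times S_u$. If $Z\subseteq\mathbb{R}^p$ and $S_z\subseteq\mathbb{R}^p$ are $\psi$-implicit inner approximations of $X$ and $S_x$, respectively, then, with $S_{zu}=S_z\times S_u$, the one-step backward reachable set $\mathrm{Pre}_{\Sigma_{lin}}(Z,S_{zu})$ is a $\psi$-implicit inner approximation of the one-step backward reachable set $\mathrm{Pre}_{\Sigma}(X,S_{xu})$; that is, $$\{x\in\mathcal{X} \mid \psi(x)\in \mathrm{Pre}_{\Sigma_{lin}}(Z,S_{zu})\}\subseteq \mathrm{Pre}_{\Sigma}(X,S_{xu}).$$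
   Context: Koopman over-approximation: given $\psi:\mathcal{X}\to\mathbb{R}^p$ and matrices $A\in\mathbb{R}^{p\times p}$, $B\in\mathbb{R}^{p\times m}$, define the approximation error $E_{A,B}(x,u)=\psi(f(x,u))-A\psi(x)-Bu$ for $(x,u)\in\mathcal{X}\times\mathcal{U}$. The uncertain linear system $\Sigma_{lin}: z^+=Az+Bu+w$ has state $z\in\mathbb{R}^p$, input $u\in\mathcal{U}$ and disturbance $w\in W\subseteq\mathbb{R}^p$. The pair $(\psi,\Sigma_{lin})$ is a Koopman over-approximation of $\Sigma$ over $\mathcal{X}_{sub}\times\mathcal{U}_{sub}$ (with $\mathcal{X}_{sub}\subseteq\mathcal{X}$, $\mathcal{U}_{sub}\subseteq\mathcal{U}$) if $E_{A,B}(x,u)\in W$ for all $(x,u)\in\mathcal{X}_{sub}\times\mathcal{U}_{sub}$. Implicit inner approximation: a set $Z\subseteq\mathbb{R}^p$ is a $\psi$-implicit inner approximation of $X\subseteq\mathcal{X}$ if $\{x\in\mathcal{X}\mid\psi(x)\in Z\}\subseteq X$. One-step backward reachable set: for an uncertain system $\Sigma_a: x^+=g(x,u,w)$ with $w\in W$, a target set $X$ and a constraint set $S_x\times S_u$, $\mathrm{Pre}_{\Sigma_a}(X,S_x\times S_u)=\{x\in S_x\mid \exists u\in S_u:\ g(x,u,W)\subseteq X\}$, where $g(x,u,W)=\{g(x,u,w)\mid w\in W\}$. For $\Sigma: x^+=f(x,u)$ (no disturbance) this is $\{x\in S_x\mid\exists u\in S_u:\ f(x,u)\in X\}$; for $\Sigma_{lin}$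 it is $\mathrm{Pre}_{\Sigma_{lin}}(Z,S_z\times S_u)=\{z\in S_z\mid\exists u\in S_u:\ Az+Bu+w\in Z\ \ \forall w\in W\}$. *)

theory Defs
  imports "HOL-Analysis.Analysis"
begin

text \<open>
  Maps on a state space \<open>\<X> \<subseteq> \<real>\<^sup>n\<close> or an input space \<open>\<U> \<subseteq> \<real>\<^sup>m\<close> are rendered as total functions;
  their values outside \<open>\<X>\<close> and \<open>\<U>\<close> play no role, since every set they are evaluated on is
  assumed to lie in \<open>\<X>\<close> or \<open>\<U>\<close> where the notions below are used.
\<close>

definition koopman_error ::
  "(real^'n \<Rightarrow> real^'m \<Rightarrow> real^'n) \<Rightarrow> (real^'n \<Rightarrow> real^'p) \<Rightarrow> real^'p^'p \<Rightarrow> real^'m^'p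
    \<Rightarrow> real^'n \<Rightarrow> real^'m \<Rightarrow> real^'p"
  where "koopman_error f \<psi> A B x u = \<psi> (f x u) - A *v \<psi> x - B *v u"

definition lin_system ::
  "real^'p^'p \<Rightarrow> real^'m^'p \<Rightarrow> real^'p \<Rightarrow> real^'m \<Rightarrow> real^'p \<Rightarrow> real^'p"
  where "lin_system A B z u w = A *v z + B *v u + w"

definition koopman_over_approximation ::
  "(real^'n \<Rightarrow> real^'m \<Rightarrow> real^'n) \<Rightarrow> (real^'n \<Rightarrow> real^'p) \<Rightarrow> real^'p^'p \<Rightarrow> real^'m^'p
    \<Rightarrow> (real^'p) set \<Rightarrow> (real^'n) set \<Rightarrow> (real^'m) set \<Rightarrow> bool"
  where "koopman_over_approximation f \<psi> A B W Xsub Usub \<longleftrightarrow>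
    (\<forall>x\<in>Xsub. \<forall>u\<in>Usub. koopman_error f \<psi> A B x u \<in> W)"

definition implicit_inner_approximation ::
  "(real^'n) set \<Rightarrow> (real^'n \<Rightarrow> real^'p) \<Rightarrow> (real^'p) set \<Rightarrow> (real^'n) set \<Rightarrow> bool"
  where "implicit_inner_approximation \<X> \<psi> Z X \<longleftrightarrow> {x \<in> \<X>. \<psi> x \<in> Z} \<subseteq> X"

definition Pre_uncertain ::
  "('s \<Rightarrow> 'u \<Rightarrow> 'w \<Rightarrow> 's) \<Rightarrow> 'w set \<Rightarrow> 's set \<Rightarrow> 's set \<Rightarrow> 'u set \<Rightarrow> 's set"
  where "Pre_uncertain g W X Sx Su = {x \<in> Sx. \<exists>u\<in>Su. g x u ` W \<subseteq> X}"

definition Pre :: "('s \<Rightarrow> 'u \<Rightarrow> 's) \<Rightarrow> 's set \<Rightarrow> 's set \<Rightarrow> 'u set \<Rightarrow> 's set"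
  where "Pre f X Sx Su = {x \<in> Sx. \<exists>u\<in>Su. f x u \<in> X}"

text \<open>The undisturbed case is the uncertain one with a single, ineffective disturbance value.\<close>

lemma Pre_eq_Pre_uncertain: "Pre f X Sx Su = Pre_uncertain (\<lambda>x u w. f x u) {()} X Sx Su"
  by (simp add: Pre_def Pre_uncertain_def)

lemma Pre_uncertain_lin_system:
  "Pre_uncertain (lin_system A B) W Z Sz Su =
    {z \<in> Sz. \<exists>u\<in>Su. \<forall>w\<in>W. A *v z + B *v u + w \<in> Z}"
  by (simp add: Pre_uncertain_def lin_system_def image_subset_iff)

end

theory Submission
  imports Defs
begin

text \<open>An input \<open>u\<close> that works for the linear system at \<open>\<psi> x\<close>
  also works for the original system at \<open>x\<close>. The approximation error at
  \<open>(x, u)\<close> is itself an admissible disturbance, and under it the linear successor of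
  \<open>\<psi> x\<close> is exactly \<open>\<psi> (f x u)\<close>. Robustness against all of
  \<open>W\<close> thus puts this lifted point in \<open>Z\<close>, and the inner approximation
  pulls it back to \<open>X\<close>.\<close>

theorem theorem2:
  fixes \<X> :: "(real^'n) set" and \<U> :: "(real^'m) set"
    and f :: "real^'n \<Rightarrow> real^'m \<Rightarrow> real^'n"
    and X Sx :: "(real^'n) set" and Su :: "(real^'m) set"
    and \<psi> :: "real^'n \<Rightarrow> real^'p"
    and A :: "real^'p^'p" and B :: "real^'m^'p"
    and W Z Sz :: "(real^'p) set"
  assumes "\<And>x u. x \<in> \<X> \<Longrightarrow> u \<in> \<U> \<Longrightarrow> f x u \<in> \<X>"
    and "X \<subseteq> \<X>" and "Sx \<subseteq> \<X>" and "Su \<subseteq> \<U>"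
    and "koopman_over_approximation f \<psi> A B W Sx Su"
    and "implicit_inner_approximation \<X> \<psi> Z X"
    and "implicit_inner_approximation \<X> \<psi> Sz Sx"
  shows "implicit_inner_approximation \<X> \<psi>
           (Pre_uncertain (lin_system A B) W Z Sz Su) (Pre f X Sx Su)"
  unfolding implicit_inner_approximation_def
proof clarify
  fix x assume x: "x \<in> \<X>" and pre: "\<psi> x \<in> Pre_uncertain (lin_system A B) W Z Sz Su"
  from pre obtain u where "\<psi> x \<in> Sz" and u: "u \<in> Su"
    and Z: "\<And>w. w \<in> W \<Longrightarrow> A *v \<psi> x + B *v u + w \<in> Z"
    unfolding Pre_uncertain_lin_system by blast
  \<comment> \<open>This must come before the error bound, which is available only on
    \<open>Sx\<close> and \<open>Su\<close>.\<close>
  then have Sx: "x \<in> Sx"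
    using assms(7) x unfolding implicit_inner_approximation_def by blast
  have "koopman_error f \<psi> A B x u \<in> W"
    using assms(5) Sx u unfolding koopman_over_approximation_def by blast
  \<comment> \<open>Taking the error as the disturbance \<open>w\<close> cancels
    \<open>A *v \<psi> x + B *v u\<close>.\<close>
  from Z[OF this] have "\<psi> (f x u) \<in> Z"
    by (simp add: koopman_error_def)
  \<comment> \<open>\<open>Z\<close> controls only those preimages under \<open>\<psi>\<close> that
    lie in \<open>\<X>\<close>.\<close>
  moreover have "f x u \<in> \<X>"
    using assms(1,4) x u by blast
  ultimately have "f x u \<in> X"
    using assms(6) unfolding implicit_inner_approximation_def by blast
  with Sx u show "x \<in> Pre f X Sx Su"
    unfolding Pre_def by blast
qed

end
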